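(* Let $1\le p_i\le+\infty$ and $\omega_i>0$ for $i=1,\dots,m$, and let $x_s\in P_s$, $x_t\in P_t$ with $s\neq t$. The shortest path problem (SPP) defining $D(x_s,x_t)$ is equivalent to the following mixed-integer problem (SPP-F1) in the variables $d_i$ $(i\in V)$, $z_{ij}$ $((i,j)\in A)$, $\lambda_{ije}$ $((i,j)\in A,\ e\in \mathrm{Ext}(F_{ij}))$: $$\min \sum_{i\in V}\omega_i d_i$$ subject to 1. $\sum_{(s,j)\in A} z_{sj}-\sum_{(h,s)\in A} z_{hs}=1$; 2. $\sum_{(i,j)\in A} z_{ij}-\sum_{(h,i)\in A} z_{hi}=0$ for all $i\in V\setminus\{s,t\}$; 3. $\sum_{(t,j)\in A} z_{tj}-\sum_{(h,t)\in A} z_{ht}=-1$; 4. $\sum_{(h,i)\in A} z_{hi}\le 1$ for all $i\in V$; 5. $\sum_{(i,j)\in A} z_{ij}\le 1$ for all $i\in V$; 6. $d_s\ge \big\|\sum_{(s,j)\in A}\sum_{e\in \mathrm{Ext}(F_{sj})}\lambda_{sje}e-x_s\big\|_{p_s}$; 7. $d_i\ge \big\|\sum_{(i,j)\in A}\sum_{e\in \mathrm{Ext}(F_{ij})}\lambda_{ije}e-\sum_{(h,i)\in A}\sum_{e\in \mathrm{Ext}(F_{hi})}\lambda_{hie}e\big\|_{p_i}$ for all $i\in V\setminus\{s,t\}$; 8. $d_t\ge \big\|x_t-\sum_{(h,t)\in A}\sum_{e\in \mathrm{Ext}(F_{ht})}\lambda_{hte}e\big\|_{p_t}$; 9. $\sum_{e\in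 \mathrm{Ext}(F_{ij})}\lambda_{ije}=z_{ij}$ for all $(i,j)\in A$; 10. $d_i\ge0$ for all $i\in V$; $z_{ij}\in\{0,1\}$ for all $(i,j)\in A$; $\lambda_{ije}\ge0$ for all $(i,j)\in A$, $e\in \mathrm{Ext}(F_{ij})$. Here "equivalent" means: the optimal value of (SPP-F1) equals $D(x_s,x_t)$; every optimal solution of (SPP), i.e. a simple path $\gamma\in\Gamma$ with gate points, gives an optimal solution of (SPP-F1) by setting $z_{ij}=1$ exactly on the arcs traversed by $\gamma$ and letting $(\lambda_{ije})_e$ be convex-combination coefficients of the gate point in $F_{ij}$ on those arcs (and $0$ elsewhere), with suitable $d$; and conversely, for every optimal solution of (SPP-F1) the arcs with $z_{ij}=1$ contain a simple path from $s$ to $t$ which, together with the gate points $\sum_{e\in \mathrm{Ext}(F_{ij})}\lambda_{ije}e$ on its arcs, is optimal for (SPP).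
   Context: Setting. $P_1,\dots,P_m\subseteq\mathbb{R}^d$ are the cells of a polyhedral subdivision, with $\mathrm{int}(P_i)\cap\mathrm{int}(P_j)=\emptyset$ for $i\ne j$; the cells are assumed to be polytopes (bounded polyhedra). Cell $P_i$ is endowed with the $\ell_{p_i}$-norm $\|\cdot\|_{p_i}$ and a weight $\omega_i>0$. The undirected graph $G=(V,E)$ has $V=\{1,\dots,m\}$ and $\{i,j\}\in E$ ($i\ne j$) iff $P_i$ and $P_j$ have a common (nonempty) face; for $\{i,j\}\in E$, $F_{ij}=F_{ji}=P_i\cap P_j$ denotes the maximal common face of $P_i$ and $P_j$ (a polytope). $\mathrm{Ext}(\cdot)$ denotes the set of extreme points of a polytope; $\mathrm{Ext}(F_{ij})=\mathrm{Ext}(P_i)\cap \mathrm{Ext}(P_j)$. $A=\{(i,j),(j,i):\{i,j\}\in E\}$ is the set of arcs of the directed version of $G$. In sums such as $\sum_{(i,j)\in A}$ or $\sum_{(h,i)\in A}$ with $i$ fixed, the sum runs over all $j$ (resp. $h$) for which the pair is an arc. A point lying in several cells is assigned to exactly one of them in advance; $s,t$ are the indices of the cells assigned to $x_s,x_t$. $\Gamma$ is the set of simple paths $(s,i_1,\dots,i_k,t)$ from $s$ to $t$ in $G$ (all vertices distinct; $k\ge0$). Problem (SPP), for $s\ne t$: with $i_0=s$, $i_{k+1}=t$, $$D(x_s,x_t)=\inf\ \ \omega_s\|y_{s i_1}-x_s\|_{p_s}+\sum_{r=1}^{k}\omega_{i_r}\|y_{i_r i_{r+1}}-y_{i_{r-1}i_r}\|_{p_{i_r}}+\omega_t\|x_t-y_{i_k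 t}\|_{p_t},$$ the infimum being over all $(s,i_1,\dots,i_k,t)\in\Gamma$ and all gate points $y_{i_r i_{r+1}}\in F_{i_r i_{r+1}}$, $r=0,\dots,k$ (value $+\infty$ if there is no feasible choice, and likewise for infeasible minimization problems). *)

theory Defs
  imports "HOL-Analysis.Analysis"
begin

definition lp_norm :: "ereal \<Rightarrow> real ^ 'n \<Rightarrow> real" where
  "lp_norm p x =
     (if p = \<infinity> then infnorm x
      else (\<Sum>k\<in>UNIV. \<bar>x $ k\<bar> powr real_of_ereal p) powr (1 / real_of_ereal p))"

(* The cells are P 1, ..., P m. The face conditions say that the subdivision is face-to-face;
   they are also satisfied when two cells are disjoint, since the empty set is a face. *)
definition polyhedral_subdivision :: "nat \<Rightarrow> (nat \<Rightarrow> (real ^ 'n) set) \<Rightarrow> bool" where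
  "polyhedral_subdivision m P \<longleftrightarrow>
     (\<forall>i\<in>{1..m}. polytope (P i)) \<and>
     (\<forall>i\<in>{1..m}. \<forall>j\<in>{1..m}. i \<noteq> j \<longrightarrow>
        interior (P i) \<inter> interior (P j) = {} \<and>
        (P i \<inter> P j) face_of P i \<and> (P i \<inter> P j) face_of P j)"

definition edges :: "nat \<Rightarrow> (nat \<Rightarrow> (real ^ 'n) set) \<Rightarrow> nat set set" where
  "edges m P = {{i, j} | i j. i \<in> {1..m} \<and> j \<in> {1..m} \<and> i \<noteq> j \<and>
     (\<exists>F. F \<noteq> {} \<and> F face_of P i \<and> F face_of P j)}"

definition arcs :: "nat \<Rightarrow> (nat \<Rightarrow> (real ^ 'n) set) \<Rightarrow> (nat \<times> nat) set" where
  "arcs m P = {(i, j). {i, j} \<in> edges m P}"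

definition common_face :: "(nat \<Rightarrow> (real ^ 'n) set) \<Rightarrow> nat \<Rightarrow> nat \<Rightarrow> (real ^ 'n) set" where
  "common_face P i j = P i \<inter> P j"

definition Ext :: "(real ^ 'n) set \<Rightarrow> (real ^ 'n) set" where
  "Ext S = {e. e extreme_point_of S}"

(* A path is the list of its vertices, both end points included. *)
definition simple_paths ::
    "nat \<Rightarrow> (nat \<Rightarrow> (real ^ 'n) set) \<Rightarrow> nat \<Rightarrow> nat \<Rightarrow> nat list set" where
  "simple_paths m P s t =
     {\<gamma>. \<gamma> \<noteq> [] \<and> hd \<gamma> = s \<and> last \<gamma> = t \<and> distinct \<gamma> \<and> set \<gamma> \<subseteq> {1..m} \<and>
          (\<forall>r. Suc r < length \<gamma> \<longrightarrow> {\<gamma> ! r, \<gamma> ! Suc r} \<in> edges m P)}"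

definition path_arcs :: "nat list \<Rightarrow> (nat \<times> nat) set" where
  "path_arcs \<gamma> = {(\<gamma> ! r, \<gamma> ! Suc r) | r. Suc r < length \<gamma>}"

(* The list y holds the gate points in the order of traversal: y ! r is the point at which the path
   passes from the cell \<gamma> ! r to the cell \<gamma> ! Suc r. *)
definition spp_feasible ::
    "nat \<Rightarrow> (nat \<Rightarrow> (real ^ 'n) set) \<Rightarrow> nat \<Rightarrow> nat \<Rightarrow> nat list \<times> (real ^ 'n) list \<Rightarrow> bool" where
  "spp_feasible m P s t = (\<lambda>(\<gamma>, y).
     \<gamma> \<in> simple_paths m P s t \<and> Suc (length y) = length \<gamma> \<and>
     (\<forall>r < length y. y ! r \<in> common_face P (\<gamma> ! r) (\<gamma> ! Suc r)))"

(* With \<gamma> = [s, i_1, ..., i_k, t] the list y has length k + 1. *)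
definition spp_cost ::
    "(nat \<Rightarrow> ereal) \<Rightarrow> (nat \<Rightarrow> real) \<Rightarrow> nat \<Rightarrow> nat \<Rightarrow> real ^ 'n \<Rightarrow> real ^ 'n \<Rightarrow>
     nat list \<times> (real ^ 'n) list \<Rightarrow> real" where
  "spp_cost p \<omega> s t xs xt = (\<lambda>(\<gamma>, y).
     \<omega> s * lp_norm (p s) (y ! 0 - xs)
     + (\<Sum>r\<in>{1..<length y}. \<omega> (\<gamma> ! r) * lp_norm (p (\<gamma> ! r)) (y ! r - y ! (r - 1)))
     + \<omega> t * lp_norm (p t) (xt - y ! (length y - 1)))"

definition spp_value ::
    "nat \<Rightarrow> (nat \<Rightarrow> (real ^ 'n) set) \<Rightarrow> (nat \<Rightarrow> ereal) \<Rightarrow> (nat \<Rightarrow> real) \<Rightarrow> nat \<Rightarrow> nat \<Rightarrow>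
     real ^ 'n \<Rightarrow> real ^ 'n \<Rightarrow> ereal" where
  "spp_value m P p \<omega> s t xs xt =
     (INF q\<in>{q. spp_feasible m P s t q}. ereal (spp_cost p \<omega> s t xs xt q))"

definition spp_optimal ::
    "nat \<Rightarrow> (nat \<Rightarrow> (real ^ 'n) set) \<Rightarrow> (nat \<Rightarrow> ereal) \<Rightarrow> (nat \<Rightarrow> real) \<Rightarrow> nat \<Rightarrow> nat \<Rightarrow>
     real ^ 'n \<Rightarrow> real ^ 'n \<Rightarrow> nat list \<Rightarrow> (real ^ 'n) list \<Rightarrow> bool" where
  "spp_optimal m P p \<omega> s t xs xt \<gamma> y \<longleftrightarrow>
     is_arg_min (spp_cost p \<omega> s t xs xt) (spp_feasible m P s t) (\<gamma>, y)"

(* The point "sum of l i j e times e over the extreme points e of F_ij". *)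
definition gate ::
    "(nat \<Rightarrow> (real ^ 'n) set) \<Rightarrow> (nat \<Rightarrow> nat \<Rightarrow> real ^ 'n \<Rightarrow> real) \<Rightarrow> nat \<Rightarrow> nat \<Rightarrow> real ^ 'n" where
  "gate P l i j = (\<Sum>e\<in>Ext (common_face P i j). l i j e *\<^sub>R e)"

(* The variables d, z, l are total functions; they are constrained only on V, on the arcs, and on
   the arcs with their extreme points, and their values elsewhere are never inspected. *)
definition f1_feasible ::
    "nat \<Rightarrow> (nat \<Rightarrow> (real ^ 'n) set) \<Rightarrow> (nat \<Rightarrow> ereal) \<Rightarrow> nat \<Rightarrow> nat \<Rightarrow>
     real ^ 'n \<Rightarrow> real ^ 'n \<Rightarrow>
     (nat \<Rightarrow> real) \<times> (nat \<Rightarrow> nat \<Rightarrow> real) \<times> (nat \<Rightarrow> nat \<Rightarrow> real ^ 'n \<Rightarrow> real) \<Rightarrow> bool" where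
  "f1_feasible m P p s t xs xt = (\<lambda>(d, z, l).
     (\<Sum>j | (s, j) \<in> arcs m P. z s j) - (\<Sum>h | (h, s) \<in> arcs m P. z h s) = 1 \<and>
     (\<forall>i\<in>{1..m} - {s, t}.
        (\<Sum>j | (i, j) \<in> arcs m P. z i j) - (\<Sum>h | (h, i) \<in> arcs m P. z h i) = 0) \<and>
     (\<Sum>j | (t, j) \<in> arcs m P. z t j) - (\<Sum>h | (h, t) \<in> arcs m P. z h t) = - 1 \<and>
     (\<forall>i\<in>{1..m}. (\<Sum>h | (h, i) \<in> arcs m P. z h i) \<le> 1) \<and>
     (\<forall>i\<in>{1..m}. (\<Sum>j | (i, j) \<in> arcs m P. z i j) \<le> 1) \<and>
     d s \<ge> lp_norm (p s) ((\<Sum>j | (s, j) \<in> arcs m P. gate P l s j) - xs) \<and>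
     (\<forall>i\<in>{1..m} - {s, t}.
        d i \<ge> lp_norm (p i) ((\<Sum>j | (i, j) \<in> arcs m P. gate P l i j)
                              - (\<Sum>h | (h, i) \<in> arcs m P. gate P l h i))) \<and>
     d t \<ge> lp_norm (p t) (xt - (\<Sum>h | (h, t) \<in> arcs m P. gate P l h t)) \<and>
     (\<forall>(i, j)\<in>arcs m P. (\<Sum>e\<in>Ext (common_face P i j). l i j e) = z i j) \<and>
     (\<forall>i\<in>{1..m}. d i \<ge> 0) \<and>
     (\<forall>(i, j)\<in>arcs m P. z i j \<in> {0, 1}) \<and>
     (\<forall>(i, j)\<in>arcs m P. \<forall>e\<in>Ext (common_face P i j). l i j e \<ge> 0))"

definition f1_cost ::
    "nat \<Rightarrow> (nat \<Rightarrow> real) \<Rightarrow>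
     (nat \<Rightarrow> real) \<times> (nat \<Rightarrow> nat \<Rightarrow> real) \<times> (nat \<Rightarrow> nat \<Rightarrow> real ^ 'n \<Rightarrow> real) \<Rightarrow> real" where
  "f1_cost m \<omega> = (\<lambda>(d, z, l). \<Sum>i\<in>{1..m}. \<omega> i * d i)"

definition f1_value ::
    "nat \<Rightarrow> (nat \<Rightarrow> (real ^ 'n) set) \<Rightarrow> (nat \<Rightarrow> ereal) \<Rightarrow> (nat \<Rightarrow> real) \<Rightarrow> nat \<Rightarrow> nat \<Rightarrow>
     real ^ 'n \<Rightarrow> real ^ 'n \<Rightarrow> ereal" where
  "f1_value m P p \<omega> s t xs xt =
     (INF q\<in>{q. f1_feasible m P p s t xs xt q}. ereal (f1_cost m \<omega> q))"

definition f1_optimal ::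
    "nat \<Rightarrow> (nat \<Rightarrow> (real ^ 'n) set) \<Rightarrow> (nat \<Rightarrow> ereal) \<Rightarrow> (nat \<Rightarrow> real) \<Rightarrow> nat \<Rightarrow> nat \<Rightarrow>
     real ^ 'n \<Rightarrow> real ^ 'n \<Rightarrow>
     (nat \<Rightarrow> real) \<Rightarrow> (nat \<Rightarrow> nat \<Rightarrow> real) \<Rightarrow> (nat \<Rightarrow> nat \<Rightarrow> real ^ 'n \<Rightarrow> real) \<Rightarrow> bool" where
  "f1_optimal m P p \<omega> s t xs xt d z l \<longleftrightarrow>
     is_arg_min (f1_cost m \<omega>) (f1_feasible m P p s t xs xt) (d, z, l)"

(* z is the incidence vector of the path, and l gives convex-combination coefficients of the gate
   points on the arcs of the path and vanishes on all other arcs. *)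
definition encodes ::
    "nat \<Rightarrow> (nat \<Rightarrow> (real ^ 'n) set) \<Rightarrow> nat list \<Rightarrow> (real ^ 'n) list \<Rightarrow>
     (nat \<Rightarrow> nat \<Rightarrow> real) \<Rightarrow> (nat \<Rightarrow> nat \<Rightarrow> real ^ 'n \<Rightarrow> real) \<Rightarrow> bool" where
  "encodes m P \<gamma> y z l \<longleftrightarrow>
     (\<forall>(i, j)\<in>arcs m P. z i j = (if (i, j) \<in> path_arcs \<gamma> then 1 else 0)) \<and>
     (\<forall>r. Suc r < length \<gamma> \<longrightarrow>
        (\<forall>e\<in>Ext (common_face P (\<gamma> ! r) (\<gamma> ! Suc r)). l (\<gamma> ! r) (\<gamma> ! Suc r) e \<ge> 0) \<and>
        (\<Sum>e\<in>Ext (common_face P (\<gamma> ! r) (\<gamma> ! Suc r)). l (\<gamma> ! r) (\<gamma> ! Suc r) e) = 1 \<and>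
        gate P l (\<gamma> ! r) (\<gamma> ! Suc r) = y ! r) \<and>
     (\<forall>(i, j)\<in>arcs m P - path_arcs \<gamma>. \<forall>e\<in>Ext (common_face P i j). l i j e = 0)"

definition path_gates ::
    "(nat \<Rightarrow> (real ^ 'n) set) \<Rightarrow> (nat \<Rightarrow> nat \<Rightarrow> real ^ 'n \<Rightarrow> real) \<Rightarrow> nat list \<Rightarrow> (real ^ 'n) list" where
  "path_gates P l \<gamma> = map (\<lambda>r. gate P l (\<gamma> ! r) (\<gamma> ! Suc r)) [0..<length \<gamma> - 1]"

end

theory Submission
  imports Defs
begin

text \<open>A path with gate points is encoded by its incidence vector and convex coefficients of the gate
points, at equal cost. Conversely, a simple path from \<open>s\<close> along arcs with \<open>z = 1\<close> that is maximal can
only stop at \<open>t\<close>: flow conservation lets it leave any other vertex, and it can return neither to \<open>s\<close>,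
which has no inflow, nor to a later vertex, whose inflow would exceed 1. The remaining arcs
with \<open>z = 1\<close> do not meet this path, so discarding them does not increase the cost.\<close>

lemma sum_eq_single:
  fixes f :: "'a \<Rightarrow> 'b::comm_monoid_add"
  assumes "finite S" "k \<in> S" "\<And>j. j \<in> S \<Longrightarrow> j \<noteq> k \<Longrightarrow> f j = 0"
  shows "sum f S = f k"
  using assms by (simp add: sum.remove[of S k])

lemma lp_norm_nonneg: "0 \<le> lp_norm p x"
  by (simp add: lp_norm_def infnorm_pos_le)

lemma lp_norm_zero: "lp_norm p 0 = 0"
  by (simp add: lp_norm_def infnorm_0)

lemma arcsD:
  assumes "(i, j) \<in> arcs m P"
  shows "i \<in> {1..m}" "j \<in> {1..m}" "i \<noteq> j"
  using assms by (auto simp: arcs_def edges_def doubleton_eq_iff)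

lemma finite_arcs_out: "finite {j. (i, j) \<in> arcs m P}"
  by (rule finite_subset[of _ "{1..m}"]) (auto dest: arcsD)

lemma finite_arcs_in: "finite {h. (h, i) \<in> arcs m P}"
  by (rule finite_subset[of _ "{1..m}"]) (auto dest: arcsD)

lemma polytope_common_face:
  assumes "polyhedral_subdivision m P" "i \<in> {1..m}" "j \<in> {1..m}"
  shows "polytope (common_face P i j)"
  using assms by (simp add: polyhedral_subdivision_def common_face_def polytope_Int)

lemma finite_Ext: "polytope S \<Longrightarrow> finite (Ext S)"
  unfolding Ext_def by (intro finite_polyhedron_extreme_points polytope_imp_polyhedron)

lemma polytope_eq_hull_Ext: "polytope S \<Longrightarrow> S = convex hull (Ext S)"
  unfolding Ext_def
  by (rule Krein_Milman_Minkowski) (simp_all add: polytope_imp_compact polytope_imp_convex)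

lemma mem_polytope_iff:
  assumes "polytope S"
  shows "y \<in> S \<longleftrightarrow>
    (\<exists>u. (\<forall>e\<in>Ext S. 0 \<le> u e) \<and> sum u (Ext S) = 1 \<and> (\<Sum>e\<in>Ext S. u e *\<^sub>R e) = y)"
  using polytope_eq_hull_Ext[OF assms] convex_hull_finite[OF finite_Ext[OF assms]] by auto

lemma path_arcsI: "Suc r < length \<gamma> \<Longrightarrow> (\<gamma> ! r, \<gamma> ! Suc r) \<in> path_arcs \<gamma>"
  by (auto simp: path_arcs_def)

lemma path_arcs_snoc:
  assumes "\<gamma> \<noteq> []"
  shows "path_arcs (\<gamma> @ [w]) \<subseteq> insert (last \<gamma>, w) (path_arcs \<gamma>)"
proof
  fix a assume "a \<in> path_arcs (\<gamma> @ [w])"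
  then obtain r where r: "r < length \<gamma>" "a = ((\<gamma> @ [w]) ! r, (\<gamma> @ [w]) ! Suc r)"
    by (auto simp: path_arcs_def)
  show "a \<in> insert (last \<gamma>, w) (path_arcs \<gamma>)"
  proof (cases "Suc r < length \<gamma>")
    case True
    then show ?thesis using r by (simp add: nth_append path_arcsI)
  next
    case False
    with r have "r = length \<gamma> - 1" "Suc r = length \<gamma>" by auto
    then show ?thesis using r assms by (simp add: nth_append last_conv_nth)
  qed
qed

lemma path_arcs_subset: "\<gamma> \<in> simple_paths m P s t \<Longrightarrow> path_arcs \<gamma> \<subseteq> arcs m P"
  by (auto simp: path_arcs_def arcs_def simple_paths_def)

lemma simple_path_endpoints:
  assumes "\<gamma> \<in> simple_paths m P s t"
  shows "\<gamma> ! 0 = s" "\<gamma> ! (length \<gamma> - 1) = t"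
  using assms by (auto simp: simple_paths_def hd_conv_nth last_conv_nth)

lemma simple_path_nth_eq_iff:
  assumes "\<gamma> \<in> simple_paths m P s t" "r < length \<gamma>"
  shows "\<gamma> ! r = s \<longleftrightarrow> r = 0" "\<gamma> ! r = t \<longleftrightarrow> Suc r = length \<gamma>"
proof -
  have dist: "distinct \<gamma>" and ne: "0 < length \<gamma>" using assms by (auto simp: simple_paths_def)
  show "\<gamma> ! r = s \<longleftrightarrow> r = 0"
    using simple_path_endpoints(1)[OF assms(1)] nth_eq_iff_index_eq[OF dist assms(2) ne] by simp
  have "length \<gamma> - 1 < length \<gamma>" using ne by simp
  from nth_eq_iff_index_eq[OF dist assms(2) this] ne
  show "\<gamma> ! r = t \<longleftrightarrow> Suc r = length \<gamma>"
    unfolding simple_path_endpoints(2)[OF assms(1)] by auto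
qed

lemma length_simple_path:
  assumes "\<gamma> \<in> simple_paths m P s t" "s \<noteq> t"
  shows "2 \<le> length \<gamma>"
proof (rule ccontr)
  assume "\<not> 2 \<le> length \<gamma>"
  then have "length \<gamma> - 1 = 0" by simp
  with simple_path_endpoints[OF assms(1)] \<open>s \<noteq> t\<close> show False by simp
qed

text \<open>The values of the right-hand sides of constraints 6--8, in terms of the outgoing and incoming
gate points \<open>a i\<close> and \<open>b i\<close> of the cells.\<close>

definition cell_length ::
    "(nat \<Rightarrow> ereal) \<Rightarrow> nat \<Rightarrow> nat \<Rightarrow> real ^ 'n \<Rightarrow> real ^ 'n \<Rightarrow>
     (nat \<Rightarrow> real ^ 'n) \<Rightarrow> (nat \<Rightarrow> real ^ 'n) \<Rightarrow> nat \<Rightarrow> real" where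
  "cell_length p s t xs xt a b i =
     (if i = s then lp_norm (p s) (a s - xs)
      else if i = t then lp_norm (p t) (xt - b t)
      else lp_norm (p i) (a i - b i))"

lemma cell_length_nonneg: "0 \<le> cell_length p s t xs xt a b i"
  by (simp add: cell_length_def lp_norm_nonneg)

lemma spp_cost_eq_sum_cells:
  fixes y :: "(real ^ 'n) list"
  assumes \<gamma>: "\<gamma> \<in> simple_paths m P s t" and "s \<noteq> t" and len: "Suc (length y) = length \<gamma>"
    and a: "\<And>r. r < length y \<Longrightarrow> a (\<gamma> ! r) = y ! r"
    and b: "\<And>r. r < length y \<Longrightarrow> b (\<gamma> ! Suc r) = y ! r"
  shows "spp_cost p \<omega> s t xs xt (\<gamma>, y) = (\<Sum>i\<in>set \<gamma>. \<omega> i * cell_length p s t xs xt a b i)"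
proof -
  let ?c = "\<lambda>i. \<omega> i * cell_length p s t xs xt a b i"
  let ?n = "length y"
  have n: "0 < ?n" using length_simple_path[OF \<gamma> \<open>s \<noteq> t\<close>] len by linarith
  have "distinct \<gamma>" using \<gamma> by (simp add: simple_paths_def)
  then have "sum ?c (set \<gamma>) = (\<Sum>r<length \<gamma>. ?c (\<gamma> ! r))"
    using sum.reindex_bij_betw[OF bij_betw_nth[OF _ refl refl], of \<gamma> ?c] by simp
  also have "\<dots> = (\<Sum>r<?n. ?c (\<gamma> ! r)) + ?c (\<gamma> ! ?n)"
    by (simp flip: len)
  also have "(\<Sum>r<?n. ?c (\<gamma> ! r)) = ?c (\<gamma> ! 0) + (\<Sum>r\<in>{1..<?n}. ?c (\<gamma> ! r))"
    using n sum.atLeast_Suc_lessThan[of 0 ?n "\<lambda>r. ?c (\<gamma> ! r)"]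
    unfolding lessThan_atLeast0 by force
  also have "?c (\<gamma> ! 0) = \<omega> s * lp_norm (p s) (y ! 0 - xs)"
    using a[of 0] n simple_path_endpoints[OF \<gamma>] by (simp add: cell_length_def)
  also have "?c (\<gamma> ! ?n) = \<omega> t * lp_norm (p t) (xt - y ! (?n - 1))"
    using b[of "?n - 1"] n simple_path_endpoints[OF \<gamma>] \<open>s \<noteq> t\<close>
    by (simp add: cell_length_def flip: len)
  also have "(\<Sum>r\<in>{1..<?n}. ?c (\<gamma> ! r)) =
      (\<Sum>r\<in>{1..<?n}. \<omega> (\<gamma> ! r) * lp_norm (p (\<gamma> ! r)) (y ! r - y ! (r - 1)))"
  proof (rule sum.cong)
    fix r assume r: "r \<in> {1..<?n}"
    then have "\<gamma> ! r \<noteq> s" "\<gamma> ! r \<noteq> t"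
      using simple_path_nth_eq_iff[OF \<gamma>, of r] len by auto
    moreover have "a (\<gamma> ! r) = y ! r" "b (\<gamma> ! r) = y ! (r - 1)"
      using a[of r] b[of "r - 1"] r by auto
    ultimately show "?c (\<gamma> ! r) = \<omega> (\<gamma> ! r) * lp_norm (p (\<gamma> ! r)) (y ! r - y ! (r - 1))"
      by (simp add: cell_length_def)
  qed simp
  finally show ?thesis by (simp add: spp_cost_def)
qed

lemma sum_out_path:
  fixes f :: "nat \<Rightarrow> nat \<Rightarrow> 'a::comm_monoid_add"
  assumes \<gamma>: "\<gamma> \<in> simple_paths m P s t"
    and f: "\<And>i j. (i, j) \<in> arcs m P - path_arcs \<gamma> \<Longrightarrow> f i j = 0"
  shows "Suc r < length \<gamma> \<Longrightarrow>
      (\<Sum>j | (\<gamma> ! r, j) \<in> arcs m P. f (\<gamma> ! r) j) = f (\<gamma> ! r) (\<gamma> ! Suc r)"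
    and "i \<notin> set \<gamma> - {t} \<Longrightarrow> (\<Sum>j | (i, j) \<in> arcs m P. f i j) = 0"
proof -
  have dist: "distinct \<gamma>" using \<gamma> by (simp add: simple_paths_def)
  {
    assume r: "Suc r < length \<gamma>"
    have "j = \<gamma> ! Suc r" if "(\<gamma> ! r, j) \<in> path_arcs \<gamma>" for j
      using that r dist by (auto simp: path_arcs_def nth_eq_iff_index_eq)
    then show "(\<Sum>j | (\<gamma> ! r, j) \<in> arcs m P. f (\<gamma> ! r) j) = f (\<gamma> ! r) (\<gamma> ! Suc r)"
      using path_arcsI[OF r] path_arcs_subset[OF \<gamma>] f
      by (intro sum_eq_single[where f = "f (\<gamma> ! r)", OF finite_arcs_out]) blast+
  next
    assume i: "i \<notin> set \<gamma> - {t}"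
    have "(i, j) \<notin> path_arcs \<gamma>" for j
    proof
      assume "(i, j) \<in> path_arcs \<gamma>"
      then obtain r where r: "Suc r < length \<gamma>" "i = \<gamma> ! r" by (auto simp: path_arcs_def)
      with simple_path_nth_eq_iff(2)[OF \<gamma>, of r] i show False by simp
    qed
    then show "(\<Sum>j | (i, j) \<in> arcs m P. f i j) = 0"
      using f by (intro sum.neutral) blast
  }
qed

lemma sum_in_path:
  fixes f :: "nat \<Rightarrow> nat \<Rightarrow> 'a::comm_monoid_add"
  assumes \<gamma>: "\<gamma> \<in> simple_paths m P s t"
    and f: "\<And>i j. (i, j) \<in> arcs m P - path_arcs \<gamma> \<Longrightarrow> f i j = 0"
  shows "Suc r < length \<gamma> \<Longrightarrow>
      (\<Sum>h | (h, \<gamma> ! Suc r) \<in> arcs m P. f h (\<gamma> ! Suc r)) = f (\<gamma> ! r) (\<gamma> ! Suc r)"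
    and "i \<notin> set \<gamma> - {s} \<Longrightarrow> (\<Sum>h | (h, i) \<in> arcs m P. f h i) = 0"
proof -
  have dist: "distinct \<gamma>" using \<gamma> by (simp add: simple_paths_def)
  {
    assume r: "Suc r < length \<gamma>"
    have "h = \<gamma> ! r" if "(h, \<gamma> ! Suc r) \<in> path_arcs \<gamma>" for h
      using that r dist by (auto simp: path_arcs_def nth_eq_iff_index_eq)
    then show "(\<Sum>h | (h, \<gamma> ! Suc r) \<in> arcs m P. f h (\<gamma> ! Suc r)) = f (\<gamma> ! r) (\<gamma> ! Suc r)"
      using path_arcsI[OF r] path_arcs_subset[OF \<gamma>] f
      by (intro sum_eq_single[where f = "\<lambda>h. f h (\<gamma> ! Suc r)", OF finite_arcs_in]) blast+
  next
    assume i: "i \<notin> set \<gamma> - {s}"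
    have "(h, i) \<notin> path_arcs \<gamma>" for h
    proof
      assume "(h, i) \<in> path_arcs \<gamma>"
      then obtain r where r: "Suc r < length \<gamma>" "i = \<gamma> ! Suc r" by (auto simp: path_arcs_def)
      with simple_path_nth_eq_iff(1)[OF \<gamma>, of "Suc r"] i show False by simp
    qed
    then show "(\<Sum>h | (h, i) \<in> arcs m P. f h i) = 0"
      using f by (intro sum.neutral) blast
  }
qed

lemma encodes_exists:
  fixes P :: "nat \<Rightarrow> (real ^ 'n) set"
  assumes sub: "polyhedral_subdivision m P" and feas: "spp_feasible m P s t (\<gamma>, y)"
  shows "\<exists>z l. encodes m P \<gamma> y z l"
proof -
  have \<gamma>: "\<gamma> \<in> simple_paths m P s t" and len: "Suc (length y) = length \<gamma>"
    and y: "\<And>r. r < length y \<Longrightarrow> y ! r \<in> common_face P (\<gamma> ! r) (\<gamma> ! Suc r)"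
    using feas by (auto simp: spp_feasible_def)
  have dist: "distinct \<gamma>" using \<gamma> by (simp add: simple_paths_def)
  define good where "good i j u \<longleftrightarrow>
      (\<forall>e\<in>Ext (common_face P i j). 0 \<le> u e) \<and> sum u (Ext (common_face P i j)) = 1 \<and>
      (\<forall>r. Suc r < length \<gamma> \<and> \<gamma> ! r = i \<longrightarrow> (\<Sum>e\<in>Ext (common_face P i j). u e *\<^sub>R e) = y ! r)"
    for i j u
  have ex: "\<exists>u. good i j u" if ij: "(i, j) \<in> path_arcs \<gamma>" for i j
  proof -
    obtain r where r: "Suc r < length \<gamma>" "i = \<gamma> ! r" "j = \<gamma> ! Suc r"
      using ij by (auto simp: path_arcs_def)
    have "(i, j) \<in> arcs m P" using ij path_arcs_subset[OF \<gamma>] by blast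
    from polytope_common_face[OF sub arcsD(1,2)[OF this]]
    have "polytope (common_face P i j)" .
    moreover have "y ! r \<in> common_face P i j" using y[of r] r len by simp
    ultimately obtain u where u: "\<forall>e\<in>Ext (common_face P i j). 0 \<le> u e"
        "sum u (Ext (common_face P i j)) = 1" "(\<Sum>e\<in>Ext (common_face P i j). u e *\<^sub>R e) = y ! r"
      using mem_polytope_iff by blast
    have "r' = r" if "Suc r' < length \<gamma>" "\<gamma> ! r' = i" for r'
      using that r nth_eq_iff_index_eq[OF dist, of r' r] by simp
    with u have "good i j u" unfolding good_def by blast
    then show ?thesis by blast
  qed
  have u: "good i j (SOME u. good i j u)" if "(i, j) \<in> path_arcs \<gamma>" for i j
    by (rule someI_ex[where P = "good i j"]) (rule ex[OF that])
  define l where "l i j = (if (i, j) \<in> path_arcs \<gamma> then SOME u. good i j u else (\<lambda>_. 0))" for i j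
  have "good (\<gamma> ! r) (\<gamma> ! Suc r) (l (\<gamma> ! r) (\<gamma> ! Suc r))" if "Suc r < length \<gamma>" for r
    using u path_arcsI[OF that] by (simp add: l_def)
  moreover have "l i j e = 0" if "(i, j) \<notin> path_arcs \<gamma>" for i j e
    using that by (simp add: l_def)
  ultimately have "encodes m P \<gamma> y (\<lambda>i j. if (i, j) \<in> path_arcs \<gamma> then 1 else 0) l"
    unfolding encodes_def gate_def good_def by blast
  then show ?thesis by blast
qed

lemma encodes_feasible:
  fixes P :: "nat \<Rightarrow> (real ^ 'n) set"
  assumes "s \<in> {1..m}" "t \<in> {1..m}" "s \<noteq> t"
    and feas: "spp_feasible m P s t (\<gamma>, y)" and enc: "encodes m P \<gamma> y z l"
  shows "\<exists>d. f1_feasible m P p s t xs xt (d, z, l) \<and>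
    f1_cost m \<omega> (d, z, l) = spp_cost p \<omega> s t xs xt (\<gamma>, y)"
proof -
  let ?A = "arcs m P"
  define a where "a i = (\<Sum>j | (i, j) \<in> ?A. gate P l i j)" for i
  define b where "b i = (\<Sum>h | (h, i) \<in> ?A. gate P l h i)" for i
  define d where "d = cell_length p s t xs xt a b"
  have \<gamma>: "\<gamma> \<in> simple_paths m P s t" and len: "Suc (length y) = length \<gamma>"
    using feas by (auto simp: spp_feasible_def)
  have set\<gamma>: "set \<gamma> \<subseteq> {1..m}" using \<gamma> by (simp add: simple_paths_def)
  have z: "z i j = (if (i, j) \<in> path_arcs \<gamma> then 1 else 0)" if "(i, j) \<in> ?A" for i j
    using enc that by (auto simp: encodes_def)
  have on: "(\<forall>e\<in>Ext (common_face P (\<gamma> ! r) (\<gamma> ! Suc r)). l (\<gamma> ! r) (\<gamma> ! Suc r) e \<ge> 0) \<and>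
      (\<Sum>e\<in>Ext (common_face P (\<gamma> ! r) (\<gamma> ! Suc r)). l (\<gamma> ! r) (\<gamma> ! Suc r) e) = 1 \<and>
      gate P l (\<gamma> ! r) (\<gamma> ! Suc r) = y ! r" if "Suc r < length \<gamma>" for r
    using enc that by (auto simp: encodes_def)
  have off: "l i j e = 0" if "(i, j) \<in> ?A - path_arcs \<gamma>" "e \<in> Ext (common_face P i j)" for i j e
    using enc that unfolding encodes_def by blast
  have z0: "z i j = 0" if "(i, j) \<in> ?A - path_arcs \<gamma>" for i j
    using z that by auto
  have g0: "gate P l i j = 0" if "(i, j) \<in> ?A - path_arcs \<gamma>" for i j
    using off[OF that] by (simp add: gate_def)
  have z1: "z (\<gamma> ! r) (\<gamma> ! Suc r) = 1" if "Suc r < length \<gamma>" for r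
    using z path_arcsI[OF that] path_arcs_subset[OF \<gamma>] by auto
  have zout: "(\<Sum>j | (i, j) \<in> ?A. z i j) = (if i \<in> set \<gamma> - {t} then 1 else 0)" for i
  proof (cases "i \<in> set \<gamma> - {t}")
    case True
    then obtain r where r: "r < length \<gamma>" "i = \<gamma> ! r" by (auto simp: in_set_conv_nth)
    with True simple_path_nth_eq_iff(2)[OF \<gamma>, of r] have "Suc r < length \<gamma>" by auto
    with sum_out_path(1)[of \<gamma> m P s t z, OF \<gamma> z0] z1 r True show ?thesis by simp
  next
    case False
    with sum_out_path(2)[of \<gamma> m P s t z, OF \<gamma> z0] show ?thesis by simp
  qed
  have zin: "(\<Sum>h | (h, i) \<in> ?A. z h i) = (if i \<in> set \<gamma> - {s} then 1 else 0)" for i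
  proof (cases "i \<in> set \<gamma> - {s}")
    case True
    then obtain r where r: "r < length \<gamma>" "i = \<gamma> ! r" by (auto simp: in_set_conv_nth)
    with True simple_path_nth_eq_iff(1)[OF \<gamma>, of r] obtain q where "r = Suc q" by (cases r) auto
    with sum_in_path(1)[of \<gamma> m P s t z, OF \<gamma> z0] z1 r True show ?thesis by simp
  next
    case False
    with sum_in_path(2)[of \<gamma> m P s t z, OF \<gamma> z0] show ?thesis by simp
  qed
  have st: "s \<in> set \<gamma>" "t \<in> set \<gamma>"
    using \<gamma> by (auto simp: simple_paths_def)
  have a: "a (\<gamma> ! r) = y ! r" and b: "b (\<gamma> ! Suc r) = y ! r" if "r < length y" for r
    using sum_out_path(1)[of \<gamma> m P s t "gate P l" r, OF \<gamma> g0]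
      sum_in_path(1)[of \<gamma> m P s t "gate P l" r, OF \<gamma> g0] on[of r] that len
    by (simp_all add: a_def b_def)
  have d0: "d i = 0" if "i \<notin> set \<gamma>" for i
  proof -
    have "a i = 0" "b i = 0"
      unfolding a_def b_def
      using sum_out_path(2)[of \<gamma> m P s t "gate P l" i, OF \<gamma> g0]
        sum_in_path(2)[of \<gamma> m P s t "gate P l" i, OF \<gamma> g0] that by auto
    moreover have "i \<noteq> s" "i \<noteq> t" using st that by auto
    ultimately show ?thesis by (simp add: d_def cell_length_def lp_norm_zero)
  qed
  have l: "(\<Sum>e\<in>Ext (common_face P i j). l i j e) = z i j \<and>
      (\<forall>e\<in>Ext (common_face P i j). l i j e \<ge> 0)" if ij: "(i, j) \<in> ?A" for i j
  proof (cases "(i, j) \<in> path_arcs \<gamma>")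
    case True
    then show ?thesis using on z[OF ij] by (auto simp: path_arcs_def)
  next
    case False
    then show ?thesis using off ij z[OF ij] by simp
  qed
  have "f1_feasible m P p s t xs xt (d, z, l)"
    unfolding f1_feasible_def prod.case a_def[symmetric] b_def[symmetric] zout zin
    using assms(1-3) st l z cell_length_nonneg
    by (auto simp: d_def cell_length_def lp_norm_nonneg)
  moreover have "f1_cost m \<omega> (d, z, l) = (\<Sum>i\<in>set \<gamma>. \<omega> i * d i)"
    unfolding f1_cost_def prod.case
    by (rule sum.mono_neutral_right) (use set\<gamma> d0 in auto)
  ultimately show ?thesis
    using spp_cost_eq_sum_cells[OF \<gamma> \<open>s \<noteq> t\<close> len a b] by (auto simp: d_def)
qed

lemma sum_01_unique:
  fixes f :: "'a \<Rightarrow> real"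
  assumes "finite S" "sum f S \<le> 1" "\<And>j. j \<in> S \<Longrightarrow> f j \<in> {0, 1}"
    "j \<in> S" "f j = 1" "k \<in> S" "k \<noteq> j"
  shows "f k = 0"
proof -
  have "sum f {j, k} \<le> sum f S"
    using assms by (intro sum_mono2) force+
  then show ?thesis using assms(2,5,7) assms(3)[OF assms(6)] by auto
qed

lemma simple_path_in_flow:
  fixes z :: "nat \<Rightarrow> nat \<Rightarrow> real"
  assumes "s \<in> {1..m}"
    and z01: "\<And>i j. (i, j) \<in> arcs m P \<Longrightarrow> z i j \<in> {0, 1}"
    and ins: "(\<Sum>h | (h, s) \<in> arcs m P. z h s) = 0"
    and outs: "(\<Sum>j | (s, j) \<in> arcs m P. z s j) = 1"
    and bal: "\<And>i. i \<in> {1..m} - {s, t} \<Longrightarrow>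
      (\<Sum>j | (i, j) \<in> arcs m P. z i j) = (\<Sum>h | (h, i) \<in> arcs m P. z h i)"
    and in1: "\<And>i. i \<in> {1..m} \<Longrightarrow> (\<Sum>h | (h, i) \<in> arcs m P. z h i) \<le> 1"
  shows "\<exists>\<gamma>\<in>simple_paths m P s t. path_arcs \<gamma> \<subseteq> {(i, j) \<in> arcs m P. z i j = 1}"
proof -
  let ?R = "{(i, j) \<in> arcs m P. z i j = 1}"
  define Q where "Q \<gamma> \<longleftrightarrow> \<gamma> \<noteq> [] \<and> hd \<gamma> = s \<and> distinct \<gamma> \<and> set \<gamma> \<subseteq> {1..m} \<and> path_arcs \<gamma> \<subseteq> ?R"
    for \<gamma>
  have "Q [s]" using \<open>s \<in> {1..m}\<close> by (simp add: Q_def path_arcs_def)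
  moreover have bound: "length \<gamma> < Suc m" if "Q \<gamma>" for \<gamma>
    using that card_mono[of "{1..m}" "set \<gamma>"] by (auto simp: Q_def distinct_card)
  ultimately obtain \<gamma> where "Q \<gamma>" and max: "\<And>\<gamma>'. Q \<gamma>' \<Longrightarrow> length \<gamma>' \<le> length \<gamma>"
    using ex_has_greatest_nat[of Q "[s]" length "Suc m"] by (auto simp: less_imp_le)
  then have ne: "\<gamma> \<noteq> []" and hd: "hd \<gamma> = s" and dist: "distinct \<gamma>" and V: "set \<gamma> \<subseteq> {1..m}"
    and R: "path_arcs \<gamma> \<subseteq> ?R"
    by (auto simp: Q_def)
  have nonneg: "0 \<le> z i j" if "(i, j) \<in> arcs m P" for i j using z01[OF that] by auto
  have no_in_s: "(h, s) \<notin> ?R" for h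
    using ins sum_nonneg_eq_0_iff[OF finite_arcs_in, of s m P "\<lambda>h. z h s"] nonneg by auto
  have "last \<gamma> = t"
  proof (rule ccontr)
    assume nt: "last \<gamma> \<noteq> t"
    let ?v = "last \<gamma>"
    have v: "?v \<in> {1..m}" using V last_in_set[OF ne] by blast
    have "(\<Sum>j | (?v, j) \<in> arcs m P. z ?v j) \<noteq> 0"
    proof (cases "?v = s")
      case True
      then show ?thesis using outs by simp
    next
      case False
      obtain r where r: "Suc r < length \<gamma>" "?v = \<gamma> ! Suc r"
        using False ne hd by (cases \<gamma> rule: rev_cases)
          (auto simp: hd_conv_nth last_conv_nth nth_append neq_Nil_conv
            intro!: that[of "length \<gamma> - 2"] split: if_splits)
      then have "(\<gamma> ! r, ?v) \<in> ?R" using R path_arcsI by auto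
      then have "(\<Sum>h | (h, ?v) \<in> arcs m P. z h ?v) \<noteq> 0"
        using sum_nonneg_eq_0_iff[OF finite_arcs_in, of ?v m P "\<lambda>h. z h ?v"] nonneg by auto
      then show ?thesis using bal[of ?v] False nt v by simp
    qed
    then obtain w where "(?v, w) \<in> arcs m P" "z ?v w \<noteq> 0"
      by (metis (no_types, lifting) mem_Collect_eq sum.neutral)
    then have w: "(?v, w) \<in> ?R" using z01 by auto
    then have wV: "w \<in> {1..m}" by (auto dest: arcsD)
    show False
    proof (cases "w \<in> set \<gamma>")
      case False
      note path_arcs_snoc[OF ne, of w]
      then have "Q (\<gamma> @ [w])"
        using False w wV ne hd dist V R unfolding Q_def by auto
      then show False using max by fastforce
    next
      case True
      then obtain q where q: "q < length \<gamma>" "w = \<gamma> ! q" by (auto simp: in_set_conv_nth)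
      show False
      proof (cases q)
        case 0
        then show False using q no_in_s w hd ne by (auto simp: hd_conv_nth)
      next
        case (Suc r)
        have rR: "(\<gamma> ! r, w) \<in> ?R" using Suc q R path_arcsI by auto
        have "\<gamma> ! r \<noteq> ?v"
          using Suc q ne dist by (auto simp: last_conv_nth nth_eq_iff_index_eq)
        then have "z (\<gamma> ! r) w = 0"
          using sum_01_unique[OF finite_arcs_in[of w m P], where f = "\<lambda>h. z h w" and j = ?v and k = "\<gamma> ! r"]
            in1[OF wV] z01 w rR by auto
        then show False using rR by simp
      qed
    qed
  qed
  then have "\<gamma> \<in> simple_paths m P s t"
    using ne hd dist V R path_arcsI[of _ \<gamma>] by (fastforce simp: simple_paths_def arcs_def)
  then show ?thesis using R by blast
qed

lemma feasible_path:
  fixes P :: "nat \<Rightarrow> (real ^ 'n) set"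
  assumes sub: "polyhedral_subdivision m P" and \<omega>: "\<forall>i\<in>{1..m}. \<omega> i > 0"
    and "s \<in> {1..m}" "t \<in> {1..m}" "s \<noteq> t"
    and feas: "f1_feasible m P p s t xs xt (d, z, l)"
  shows "\<exists>\<gamma>\<in>simple_paths m P s t. path_arcs \<gamma> \<subseteq> {(i, j) \<in> arcs m P. z i j = 1} \<and>
    spp_feasible m P s t (\<gamma>, path_gates P l \<gamma>) \<and>
    spp_cost p \<omega> s t xs xt (\<gamma>, path_gates P l \<gamma>) \<le> f1_cost m \<omega> (d, z, l)"
proof -
  let ?A = "arcs m P"
  define a where "a i = (\<Sum>j | (i, j) \<in> ?A. gate P l i j)" for i
  define b where "b i = (\<Sum>h | (h, i) \<in> ?A. gate P l h i)" for i
  have fs: "(\<Sum>j | (s, j) \<in> ?A. z s j) - (\<Sum>h | (h, s) \<in> ?A. z h s) = 1"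
    and bal: "\<And>i. i \<in> {1..m} - {s, t} \<Longrightarrow>
        (\<Sum>j | (i, j) \<in> ?A. z i j) - (\<Sum>h | (h, i) \<in> ?A. z h i) = 0"
    and in1: "\<And>i. i \<in> {1..m} \<Longrightarrow> (\<Sum>h | (h, i) \<in> ?A. z h i) \<le> 1"
    and out1: "\<And>i. i \<in> {1..m} \<Longrightarrow> (\<Sum>j | (i, j) \<in> ?A. z i j) \<le> 1"
    and d: "d s \<ge> lp_norm (p s) (a s - xs)"
      "\<And>i. i \<in> {1..m} - {s, t} \<Longrightarrow> d i \<ge> lp_norm (p i) (a i - b i)"
      "d t \<ge> lp_norm (p t) (xt - b t)"
    and lz: "\<And>i j. (i, j) \<in> ?A \<Longrightarrow> (\<Sum>e\<in>Ext (common_face P i j). l i j e) = z i j"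
    and d0: "\<And>i. i \<in> {1..m} \<Longrightarrow> d i \<ge> 0"
    and z01: "\<And>i j. (i, j) \<in> ?A \<Longrightarrow> z i j \<in> {0, 1}"
    and l0: "\<And>i j e. (i, j) \<in> ?A \<Longrightarrow> e \<in> Ext (common_face P i j) \<Longrightarrow> l i j e \<ge> 0"
    using feas unfolding f1_feasible_def prod.case a_def[symmetric] b_def[symmetric] by auto
  have "(\<Sum>h | (h, s) \<in> ?A. z h s) \<ge> 0"
    using z01 by (intro sum_nonneg) force
  with fs out1[OF \<open>s \<in> {1..m}\<close>]
  have s: "(\<Sum>h | (h, s) \<in> ?A. z h s) = 0" "(\<Sum>j | (s, j) \<in> ?A. z s j) = 1"
    by linarith+
  obtain \<gamma> where \<gamma>: "\<gamma> \<in> simple_paths m P s t" and z1: "path_arcs \<gamma> \<subseteq> {(i, j) \<in> ?A. z i j = 1}"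
    using simple_path_in_flow[of s m P z t] \<open>s \<in> {1..m}\<close> z01 s bal in1 by force
  let ?y = "path_gates P l \<gamma>"
  have V: "set \<gamma> \<subseteq> {1..m}" and ne: "\<gamma> \<noteq> []" using \<gamma> by (auto simp: simple_paths_def)
  have len: "Suc (length ?y) = length \<gamma>" using ne by (simp add: path_gates_def)
  have y: "?y ! r = gate P l (\<gamma> ! r) (\<gamma> ! Suc r)" if "r < length ?y" for r
    using that by (simp add: path_gates_def)
  have poly: "polytope (common_face P i j)" if "(i, j) \<in> ?A" for i j
    using arcsD[OF that] polytope_common_face[OF sub] by blast
  have g0: "gate P l i j = 0" if ij: "(i, j) \<in> ?A" "z i j = 0" for i j
    using sum_nonneg_eq_0_iff[OF finite_Ext[OF poly[OF ij(1)]], of "l i j"] lz[OF ij(1)] l0[OF ij(1)] ij(2)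
    by (simp add: gate_def)
  have arc: "(\<gamma> ! r, \<gamma> ! Suc r) \<in> ?A" "z (\<gamma> ! r) (\<gamma> ! Suc r) = 1" if "r < length ?y" for r
    using z1 path_arcsI[of r \<gamma>] that len by auto
  have feas': "spp_feasible m P s t (\<gamma>, ?y)"
    unfolding spp_feasible_def prod.case
  proof (intro conjI allI impI \<gamma> len)
    fix r assume r: "r < length ?y"
    show "?y ! r \<in> common_face P (\<gamma> ! r) (\<gamma> ! Suc r)"
      unfolding mem_polytope_iff[OF poly[OF arc(1)[OF r]]] y[OF r] gate_def
      using lz[OF arc(1)[OF r]] l0[OF arc(1)[OF r]] arc(2)[OF r] by auto
  qed
  have a: "a (\<gamma> ! r) = ?y ! r" if r: "r < length ?y" for r
    unfolding a_def y[OF r]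
  proof (rule sum_eq_single[OF finite_arcs_out])
    fix j assume j: "j \<in> {j. (\<gamma> ! r, j) \<in> ?A}" "j \<noteq> \<gamma> ! Suc r"
    have "z (\<gamma> ! r) j = 0"
      by (rule sum_01_unique[OF finite_arcs_out, where j = "\<gamma> ! Suc r"])
        (use j arc[OF r] z01 out1[OF arcsD(1)[OF arc(1)[OF r]]] in auto)
    then show "gate P l (\<gamma> ! r) j = 0" using g0 j by simp
  qed (use arc[OF r] in auto)
  have b: "b (\<gamma> ! Suc r) = ?y ! r" if r: "r < length ?y" for r
    unfolding b_def y[OF r]
  proof (rule sum_eq_single[where f = "\<lambda>h. gate P l h (\<gamma> ! Suc r)", OF finite_arcs_in])
    fix h assume h: "h \<in> {h. (h, \<gamma> ! Suc r) \<in> ?A}" "h \<noteq> \<gamma> ! r"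
    have "z h (\<gamma> ! Suc r) = 0"
      by (rule sum_01_unique[where f = "\<lambda>h. z h (\<gamma> ! Suc r)", OF finite_arcs_in, where j = "\<gamma> ! r"])
        (use h arc[OF r] z01 in1[OF arcsD(2)[OF arc(1)[OF r]]] in auto)
    then show "gate P l h (\<gamma> ! Suc r) = 0" using g0 h by simp
  qed (use arc[OF r] in auto)
  have "spp_cost p \<omega> s t xs xt (\<gamma>, ?y) = (\<Sum>i\<in>set \<gamma>. \<omega> i * cell_length p s t xs xt a b i)"
    by (rule spp_cost_eq_sum_cells[OF \<gamma> \<open>s \<noteq> t\<close> len a b])
  also have "\<dots> \<le> (\<Sum>i\<in>set \<gamma>. \<omega> i * d i)"
    using V \<omega> d by (intro sum_mono mult_left_mono) (auto simp: cell_length_def less_imp_le subset_iff)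
  also have "\<dots> \<le> (\<Sum>i\<in>{1..m}. \<omega> i * d i)"
    using V \<omega> d0 by (intro sum_mono2) (auto simp: less_imp_le)
  finally have "spp_cost p \<omega> s t xs xt (\<gamma>, ?y) \<le> f1_cost m \<omega> (d, z, l)"
    by (simp add: f1_cost_def)
  with \<gamma> z1 feas' show ?thesis by blast
qed

theorem theorem12:
  fixes m s t :: nat
    and P :: "nat \<Rightarrow> (real ^ 'n) set"
    and p :: "nat \<Rightarrow> ereal"
    and \<omega> :: "nat \<Rightarrow> real"
    and xs xt :: "real ^ 'n"
  assumes "polyhedral_subdivision m P"
    and "\<forall>i\<in>{1..m}. 1 \<le> p i"
    and "\<forall>i\<in>{1..m}. \<omega> i > 0"
    and "s \<in> {1..m}" and "t \<in> {1..m}" and "s \<noteq> t"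
    and "xs \<in> P s" and "xt \<in> P t"
  shows "f1_value m P p \<omega> s t xs xt = spp_value m P p \<omega> s t xs xt \<and>
    (\<forall>\<gamma> y. spp_optimal m P p \<omega> s t xs xt \<gamma> y \<longrightarrow>
       (\<exists>z l. encodes m P \<gamma> y z l) \<and>
       (\<forall>z l. encodes m P \<gamma> y z l \<longrightarrow> (\<exists>d. f1_optimal m P p \<omega> s t xs xt d z l))) \<and>
    (\<forall>d z l. f1_optimal m P p \<omega> s t xs xt d z l \<longrightarrow>
       (\<exists>\<gamma>\<in>simple_paths m P s t.
          path_arcs \<gamma> \<subseteq> {(i, j) \<in> arcs m P. z i j = 1} \<and>
          spp_optimal m P p \<omega> s t xs xt \<gamma> (path_gates P l \<gamma>)))"
proof -
  let ?F = "f1_feasible m P p s t xs xt" and ?S = "spp_feasible m P s t"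
  let ?cf = "f1_cost m \<omega>" and ?cs = "spp_cost p \<omega> s t xs xt"
  have enc: "\<exists>d. ?F (d, z, l) \<and> ?cf (d, z, l) = ?cs (\<gamma>, y)"
    if "?S (\<gamma>, y)" "encodes m P \<gamma> y z l" for \<gamma> y z l
    using encodes_feasible[OF assms(4-6) that] by blast
  have dec: "\<exists>\<gamma>\<in>simple_paths m P s t. path_arcs \<gamma> \<subseteq> {(i, j) \<in> arcs m P. z i j = 1} \<and>
      ?S (\<gamma>, path_gates P l \<gamma>) \<and> ?cs (\<gamma>, path_gates P l \<gamma>) \<le> ?cf (d, z, l)"
    if "?F (d, z, l)" for d z l
    using feasible_path[OF assms(1,3-6) that] .
  have S_to_F: "\<exists>q'. ?F q' \<and> ?cf q' = ?cs q" if "?S q" for q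
    using encodes_exists[OF assms(1)] enc that by (cases q) blast
  have F_to_S: "\<exists>q'. ?S q' \<and> ?cs q' \<le> ?cf q" if "?F q" for q
    using dec that by (cases q) blast
  have "f1_value m P p \<omega> s t xs xt = spp_value m P p \<omega> s t xs xt"
    unfolding f1_value_def spp_value_def
  proof (rule antisym)
    show "(INF q\<in>{q. ?F q}. ereal (?cf q)) \<le> (INF q\<in>{q. ?S q}. ereal (?cs q))"
    proof (rule INF_mono)
      fix q assume "q \<in> {q. ?S q}"
      then show "\<exists>q'\<in>{q. ?F q}. ereal (?cf q') \<le> ereal (?cs q)"
        using S_to_F[of q] by (metis mem_Collect_eq order_refl)
    qed
    show "(INF q\<in>{q. ?S q}. ereal (?cs q)) \<le> (INF q\<in>{q. ?F q}. ereal (?cf q))"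
    proof (rule INF_mono)
      fix q assume "q \<in> {q. ?F q}"
      then show "\<exists>q'\<in>{q. ?S q}. ereal (?cs q') \<le> ereal (?cf q)"
        using F_to_S[of q] by auto
    qed
  qed
  moreover have "(\<exists>z l. encodes m P \<gamma> y z l) \<and>
      (\<forall>z l. encodes m P \<gamma> y z l \<longrightarrow> (\<exists>d. f1_optimal m P p \<omega> s t xs xt d z l))"
    if "spp_optimal m P p \<omega> s t xs xt \<gamma> y" for \<gamma> y
  proof (intro conjI allI impI)
    have feas: "?S (\<gamma>, y)" and opt: "\<And>q. ?S q \<Longrightarrow> ?cs (\<gamma>, y) \<le> ?cs q"
      using that by (auto simp: spp_optimal_def is_arg_min_linorder)
    show "\<exists>z l. encodes m P \<gamma> y z l" using encodes_exists[OF assms(1) feas] .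
    fix z l assume "encodes m P \<gamma> y z l"
    then obtain d where d: "?F (d, z, l)" "?cf (d, z, l) = ?cs (\<gamma>, y)"
      using enc feas by blast
    have "?cf (d, z, l) \<le> ?cf q" if "?F q" for q
      using F_to_S[OF that] opt d(2) by fastforce
    with d show "\<exists>d. f1_optimal m P p \<omega> s t xs xt d z l"
      by (auto simp: f1_optimal_def is_arg_min_linorder)
  qed
  moreover have "\<exists>\<gamma>\<in>simple_paths m P s t. path_arcs \<gamma> \<subseteq> {(i, j) \<in> arcs m P. z i j = 1} \<and>
      spp_optimal m P p \<omega> s t xs xt \<gamma> (path_gates P l \<gamma>)"
    if "f1_optimal m P p \<omega> s t xs xt d z l" for d z l
  proof -
    have feas: "?F (d, z, l)" and opt: "\<And>q. ?F q \<Longrightarrow> ?cf (d, z, l) \<le> ?cf q"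
      using that by (auto simp: f1_optimal_def is_arg_min_linorder)
    obtain \<gamma> where \<gamma>: "\<gamma> \<in> simple_paths m P s t"
        "path_arcs \<gamma> \<subseteq> {(i, j) \<in> arcs m P. z i j = 1}"
        "?S (\<gamma>, path_gates P l \<gamma>)" "?cs (\<gamma>, path_gates P l \<gamma>) \<le> ?cf (d, z, l)"
      using dec[OF feas] by blast
    have "?cs (\<gamma>, path_gates P l \<gamma>) \<le> ?cs q" if "?S q" for q
      using S_to_F[OF that] opt \<gamma>(4) by fastforce
    with \<gamma> show ?thesis
      by (auto simp: spp_optimal_def is_arg_min_linorder)
  qed
  ultimately show ?thesis by blast
qed

end
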